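(* Let $1\le m\le n$ and let $s,t\ge 1$ be integers. Then $$\#\{\pi \in \mathrm{PF}(m,n) : \mathrm{slev}(\pi)=s \text{ and } \mathrm{lel}(\pi)=t\}$$ $$=\binom{m-2}{s-1,\,t-1,\,m-s-t}(n-m+1)^{s}(m-1)^{m-s-t+1}+\binom{m-1}{t-1,\,s-t,\,m-s}\,s\,(n-m+1)(n-m)^{s-t}m^{m-s-1}.$$
   Context: $\mathrm{PF}(m,n)$ is the set of parking functions with $m$ cars and $n$ spots: there are $n$ spots $1,\dots,n$ in order on a one-way street; cars $1,\dots,m$ enter one by one, car $i$ drives to its preferred spot $\pi_i\in\{1,\dots,n\}$ and parks there if it is free, otherwise it parks in the first available later spot; $\pi=(\pi_1,\dots,\pi_m)$ is a parking function if all cars succeed in parking. Equivalently, $\#\{k:\pi_k\le i\}\ge m-n+i$ for $i=n-m+1,\dots,n$. $\mathrm{lel}(\pi)=\#\{i:\pi_i=\pi_1\}$ (leading elements) and $\mathrm{slev}(\pi)=\#\{i:\pi_i\in\{1,2,\dots,n-m+1\}\}$ (size of level set). Conventions: $\binom{a}{b_1,b_2,b_3}=\frac{a!}{b_1!b_2!b_3!}$ is a multinomial coefficient; it is $0$ if some lower entry is negative, and then the whole corresponding term is $0$; $0^0=1$. *)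

theory Defs
  imports Complex_Main
begin

text \<open>
  Spots are numbered \<open>1, \<dots>, n\<close>; \<open>first_free occ p\<close> is the first spot from \<open>p\<close> onwards (on an
  unbounded street) that is not in the finite set \<open>occ\<close> of occupied spots. A car that would have
  to park beyond spot \<open>n\<close> fails to park.
\<close>

definition first_free :: "nat set \<Rightarrow> nat \<Rightarrow> nat" where
  "first_free occ p = (LEAST j. p \<le> j \<and> j \<notin> occ)"

fun all_park :: "nat \<Rightarrow> nat set \<Rightarrow> nat list \<Rightarrow> bool" where
  "all_park n occ [] \<longleftrightarrow> True"
| "all_park n occ (p # ps) \<longleftrightarrow>
     first_free occ p \<le> n \<and> all_park n (insert (first_free occ p) occ) ps"

text \<open>
  The preference of car \<open>i\<close> is the list entry at position \<open>i - 1\<close>.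
\<close>

definition PF :: "nat \<Rightarrow> nat \<Rightarrow> nat list set" where
  "PF m n = {\<pi>. length \<pi> = m \<and> set \<pi> \<subseteq> {1..n} \<and> all_park n {} \<pi>}"

definition lel :: "nat list \<Rightarrow> nat" where
  "lel \<pi> = card {i. i < length \<pi> \<and> \<pi> ! i = \<pi> ! 0}"

text \<open>
  The statistic depends on the number of spots, hence the parameter \<open>n\<close>; the number \<open>m\<close> of cars
  is the length of the list. The natural-number subtraction is exact as long as \<open>m \<le> n\<close>.
\<close>

definition slev :: "nat \<Rightarrow> nat list \<Rightarrow> nat" where
  "slev n \<pi> = card {i. i < length \<pi> \<and> \<pi> ! i \<in> {1..n - length \<pi> + 1}}"

text \<open>
  Trinomial coefficients take integer arguments so that negative lower entries can be recognised.
  Only arguments with \<open>a = b\<^sub>1 + b\<^sub>2 + b\<^sub>3\<close> are meaningful; for these, \<open>a < 0\<close> forces a negative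
  lower entry, so \<open>nat a\<close> never truncates in the second branch.
\<close>

definition trinomial :: "int \<Rightarrow> int \<Rightarrow> int \<Rightarrow> int \<Rightarrow> real" where
  "trinomial a b\<^sub>1 b\<^sub>2 b\<^sub>3 =
     (if b\<^sub>1 < 0 \<or> b\<^sub>2 < 0 \<or> b\<^sub>3 < 0 then 0
      else fact (nat a) / (fact (nat b\<^sub>1) * fact (nat b\<^sub>2) * fact (nat b\<^sub>3)))"

end

theory Submission
  imports Defs "HOL-Number_Theory.Cong"
begin

text \<open>
  Put \<open>L = n - m + 1\<close> and call an entry low if it is at most \<open>L\<close>, high otherwise. A preference list
  is a parking function iff, for every \<open>j\<close>, at most \<open>n - j + 1\<close> of its entries are \<open>\<ge> j\<close>
  (\<open>PF_iff_tail_counts\<close>). For \<open>j \<le> L\<close> this bound is at least \<open>m\<close>, so only the high entries are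
  constrained, and after subtracting \<open>L\<close> their constraint says exactly that they form a parking
  function with \<open>m - s\<close> cars and \<open>m - 1\<close> spots, where \<open>s\<close> is the number of low entries
  (\<open>PF_slev_iff\<close>). Hence a parking function with \<open>slev = s\<close> is a shuffle of an arbitrary list of
  \<open>s\<close> low entries with such a smaller parking function. The first entry decides which of the two
  lists contains all the leading elements; the first term of the formula counts the case of a
  high first entry, the second term that of a low one (\<open>card_PF_slev_lel\<close>).

  Both cases need the number of parking functions with \<open>k\<close> cars and \<open>N\<close> spots, the case of a high
  first entry with prescribed \<open>lel\<close>. Pollak's circle argument gives the two at once: closing the street to a circle
  by one additional spot makes parking commute with rotations, and the additional spot stays
  empty exactly for the parking functions. As \<open>N + 1 - k\<close> of the \<open>N + 1\<close> spots stay empty, in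
  every rotation-invariant set of preference lists the proportion of parking functions is
  \<open>(N + 1 - k) / (N + 1)\<close> (\<open>card_rotation_invariant_PF\<close>). The lists with \<open>lel = t\<close> form such a set,
  since a rotation is injective on the spots.
\<close>

section \<open>Parking on a street: the counting criterion\<close>

lemma first_free_notin:
  assumes "finite occ"
  shows "p \<le> first_free occ p \<and> first_free occ p \<notin> occ"
proof -
  obtain q where q: "q \<notin> occ \<union> {..<p}"
    using assms ex_new_if_finite[of "occ \<union> {..<p}"] by auto
  show ?thesis unfolding first_free_def
    by (rule LeastI[of _ q]) (use q in auto)
qed

lemma below_first_free: "p \<le> j \<Longrightarrow> j < first_free occ p \<Longrightarrow> j \<in> occ"
  unfolding first_free_def using not_less_Least by blast

text \<open>
  Allowing already occupied spots makes the criterion inductive. When a car that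
  prefers \<open>p\<close> takes spot \<open>f\<close>, the tail counts at \<open>j \<le> p\<close> and at \<open>j > f\<close> do not change; at
  \<open>p < j \<le> f\<close> they grow by one, but the bound there follows from the one at \<open>p\<close>, because the block from
  \<open>p\<close> to \<open>f - 1\<close> is full. If no spot is left, the bound fails at \<open>p\<close> itself.
\<close>

lemma all_park_iff_tail_counts:
  assumes "occ \<subseteq> {1..n}" "set ps \<subseteq> {1..n}"
  shows "all_park n occ ps \<longleftrightarrow>
    (\<forall>j\<in>{1..n}. card (occ \<inter> {j..n}) + length (filter (\<lambda>x. j \<le> x) ps) + j \<le> n + 1)"
  using assms
proof (induction ps arbitrary: occ)
  case Nil
  have "card (occ \<inter> {j..n}) + j \<le> n + 1" if "j \<in> {1..n}" for j
    using card_mono[of "{j..n}" "occ \<inter> {j..n}"] that by auto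
  then show ?case by simp
next
  case (Cons p ps)
  define f where "f = first_free occ p"
  have fin: "finite occ" using Cons.prems(1) finite_subset by blast
  have f: "p \<le> f" "f \<notin> occ" using first_free_notin[OF fin] by (auto simp: f_def)
  have p: "1 \<le> p" "p \<le> n" using Cons.prems by auto
  have block: "i \<in> occ" if "p \<le> i" "i < f" for i
    using below_first_free that unfolding f_def by blast
  have split: "card (occ \<inter> {p..n}) = (j - p) + card (occ \<inter> {j..n})"
    if "p \<le> j" "j \<le> f" "j \<le> n + 1" for j
  proof -
    have "occ \<inter> {p..n} = {p..<j} \<union> (occ \<inter> {j..n})" using block that by fastforce
    then show ?thesis using card_Un_disjoint[of "{p..<j}" "occ \<inter> {j..n}"] fin
      by fastforce
  qed
  show ?case
  proof (cases "f \<le> n")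
    case False
    have "card (occ \<inter> {p..n}) = n + 1 - p" using split[of "n + 1"] False p by auto
    then have "\<not> card (occ \<inter> {p..n}) + length (filter (\<lambda>x. p \<le> x) (p # ps)) + p \<le> n + 1"
      using p by simp
    then show ?thesis using False p unfolding f_def by (auto intro!: bexI[of _ p])
  next
    case True
    have ins: "card (insert f occ \<inter> {j..n}) = card (occ \<inter> {j..n}) + (if j \<le> f then 1 else 0)"
      for j using f True fin by (auto simp: Int_insert_left)
    have IH: "all_park n (insert f occ) ps \<longleftrightarrow>
      (\<forall>j\<in>{1..n}. card (insert f occ \<inter> {j..n}) + length (filter (\<lambda>x. j \<le> x) ps) + j \<le> n + 1)"
      using Cons True f p by (intro Cons.IH) auto
    have "(\<forall>j\<in>{1..n}. card (insert f occ \<inter> {j..n}) + length (filter (\<lambda>x. j \<le> x) ps) + j \<le> n + 1)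
      \<longleftrightarrow> (\<forall>j\<in>{1..n}. card (occ \<inter> {j..n}) + length (filter (\<lambda>x. j \<le> x) (p # ps)) + j \<le> n + 1)"
      (is "?new \<longleftrightarrow> ?old")
    proof
      assume ?new
      then show ?old using f by (fastforce simp: ins)
    next
      assume old: ?old
      show ?new
      proof
        fix j assume j: "j \<in> {1..n}"
        show "card (insert f occ \<inter> {j..n}) + length (filter (\<lambda>x. j \<le> x) ps) + j \<le> n + 1"
        proof (cases "p < j \<and> j \<le> f")
          case True
          \<comment> \<open>The only tail counts that grow: compare with the bound at \<open>p\<close> across the full block.\<close>
          have "length (filter (\<lambda>x. j \<le> x) ps) \<le> length (filter (\<lambda>x. p \<le> x) ps)"
            using True by (induction ps) auto
          moreover have "card (occ \<inter> {p..n}) + length (filter (\<lambda>x. p \<le> x) (p # ps)) + p \<le> n + 1"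
            by (rule bspec[OF old]) (use p in simp)
          ultimately show ?thesis using split[of j] True j by (simp add: ins)
        next
          case False
          then show ?thesis using old[rule_format, OF j] f by (auto simp: ins split: if_splits)
        qed
      qed
    qed
    then show ?thesis using IH True unfolding f_def by simp
  qed
qed

lemma PF_iff_tail_counts:
  "\<pi> \<in> PF m n \<longleftrightarrow> length \<pi> = m \<and> set \<pi> \<subseteq> {1..n} \<and>
     (\<forall>j\<in>{1..n}. length (filter (\<lambda>x. j \<le> x) \<pi>) + j \<le> n + 1)"
  unfolding PF_def using all_park_iff_tail_counts[of "{}" n \<pi>] by auto

section \<open>Parking on a circle\<close>

definition rot :: "nat \<Rightarrow> nat \<Rightarrow> nat \<Rightarrow> nat" where
  "rot M r x = (x + r) mod M"

text \<open>
  The circle has the spots \<open>0, \<dots>, M - 1\<close>. For \<open>M = N + 1\<close> the spots \<open>1, \<dots>, N\<close> are those of the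
  street, and \<open>0\<close> is the additional spot, reached after \<open>N\<close>.
\<close>

definition circ_free :: "nat \<Rightarrow> nat set \<Rightarrow> nat \<Rightarrow> nat" where
  "circ_free M occ p = (p + (LEAST d. (p + d) mod M \<notin> occ)) mod M"

fun circ_occ :: "nat \<Rightarrow> nat set \<Rightarrow> nat list \<Rightarrow> nat set" where
  "circ_occ M occ [] = occ"
| "circ_occ M occ (p # ps) = circ_occ M (insert (circ_free M occ p) occ) ps"

lemma inj_on_rot: "inj_on (rot M r) {..<M}"
proof (rule inj_onI)
  fix x y assume "x \<in> {..<M}" "y \<in> {..<M}" "rot M r x = rot M r y"
  then have "[x + r = y + r] (mod M)" by (simp add: rot_def cong_def)
  then have "[x = y] (mod M)" by (simp add: cong_add_rcancel_nat)
  then show "x = y" using \<open>x \<in> _\<close> \<open>y \<in> _\<close> by (simp add: cong_def)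
qed

lemma rot_less: "0 < M \<Longrightarrow> rot M r x < M"
  by (simp add: rot_def)

lemma rot_inverse: "a + b = M \<Longrightarrow> x < M \<Longrightarrow> rot M b (rot M a x) = x"
  by (simp add: rot_def mod_add_left_eq add.assoc)

lemma circ_free_less: "0 < M \<Longrightarrow> circ_free M occ p < M"
  by (simp add: circ_free_def)

lemma circ_free_notin:
  assumes "occ \<subset> {..<M}" "p < M"
  shows "circ_free M occ p \<notin> occ"
proof -
  obtain q where q: "q < M" "q \<notin> occ" using assms by auto
  then have "(p + (M - p + q)) mod M \<notin> occ" using assms by simp
  then show ?thesis unfolding circ_free_def by (rule LeastI)
qed

lemma circ_occ_subset: "0 < M \<Longrightarrow> occ \<subseteq> {..<M} \<Longrightarrow> circ_occ M occ ps \<subseteq> {..<M}"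
  by (induction ps arbitrary: occ) (auto simp: circ_free_less)

lemma circ_occ_mono: "occ \<subseteq> circ_occ M occ ps"
proof (induction ps arbitrary: occ)
  case (Cons p ps)
  show ?case using Cons.IH[of "insert (circ_free M occ p) occ"] by auto
qed simp

lemma card_circ_occ:
  assumes "occ \<subseteq> {..<M}" "set ps \<subseteq> {..<M}" "card occ + length ps \<le> M"
  shows "card (circ_occ M occ ps) = card occ + length ps"
  using assms
proof (induction ps arbitrary: occ)
  case (Cons p ps)
  have fin: "finite occ" using Cons.prems(1) finite_subset by blast
  have "occ \<noteq> {..<M}" using Cons.prems(3) by auto
  then have free: "circ_free M occ p \<notin> occ" using Cons.prems by (intro circ_free_notin) auto
  have "circ_free M occ p < M" using Cons.prems(2) by (intro circ_free_less) auto
  then show ?case using Cons free fin by simp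
qed simp

lemma circ_free_rot:
  assumes "occ \<subseteq> {..<M}" "p < M"
  shows "circ_free M (rot M r ` occ) (rot M r p) = rot M r (circ_free M occ p)"
proof -
  have shift: "(rot M r p + d) mod M = rot M r ((p + d) mod M)" for d
    unfolding rot_def by (simp only: mod_add_left_eq) (simp only: ac_simps)
  have "rot M r ((p + d) mod M) \<in> rot M r ` occ \<longleftrightarrow> (p + d) mod M \<in> occ" for d
    using assms by (intro inj_on_image_mem_iff[OF inj_on_rot]) auto
  then show ?thesis unfolding circ_free_def by (simp add: shift)
qed

lemma circ_occ_rot:
  assumes "occ \<subseteq> {..<M}" "set ps \<subseteq> {..<M}"
  shows "circ_occ M (rot M r ` occ) (map (rot M r) ps) = rot M r ` circ_occ M occ ps"
  using assms
proof (induction ps arbitrary: occ)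
  case (Cons p ps)
  have "insert (circ_free M occ p) occ \<subseteq> {..<M}" using Cons.prems by (auto intro: circ_free_less)
  from Cons.IH[OF this] show ?case using Cons.prems by (simp add: circ_free_rot)
qed simp

text \<open>
  A car that runs off the street would stop at \<open>N + 1\<close>, and reduction modulo \<open>N + 1\<close> sends it to the
  additional spot.
\<close>

lemma circ_free_eq_first_free:
  assumes "occ \<subseteq> {1..N}" "1 \<le> p" "p \<le> N"
  shows "first_free occ p \<le> Suc N" "circ_free (Suc N) occ p = first_free occ p mod Suc N"
proof -
  define f where "f = first_free occ p"
  have fin: "finite occ" using assms(1) finite_subset by blast
  have f: "p \<le> f" "f \<notin> occ" using first_free_notin[OF fin] by (auto simp: f_def)
  show le: "first_free occ p \<le> Suc N"
    unfolding first_free_def by (rule Least_le) (use assms in auto)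
  have "(LEAST d. (p + d) mod Suc N \<notin> occ) = f - p"
  proof (rule Least_equality)
    show "(p + (f - p)) mod Suc N \<notin> occ"
      using f le assms(1) by (cases "f = Suc N") (auto simp: f_def)
  next
    fix d assume d: "(p + d) mod Suc N \<notin> occ"
    show "f - p \<le> d"
    proof (rule ccontr)
      assume "\<not> f - p \<le> d"
      then have "p + d < f" by simp
      then show False using d below_first_free[of p "p + d" occ] le unfolding f_def by simp
    qed
  qed
  then show "circ_free (Suc N) occ p = first_free occ p mod Suc N"
    using f unfolding circ_free_def by (simp add: f_def)
qed

text \<open>
  As long as the additional spot is empty, the circle behaves like the street; it is taken by the
  first car that either prefers it or runs off the street, and it is never vacated.
\<close>

lemma park_iff_zero_empty:
  assumes "occ \<subseteq> {1..N}" "set ps \<subseteq> {..N}"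
  shows "set ps \<subseteq> {1..N} \<and> all_park N occ ps \<longleftrightarrow> 0 \<notin> circ_occ (Suc N) occ ps"
  using assms
proof (induction ps arbitrary: occ)
  case Nil
  then show ?case by auto
next
  case (Cons p ps)
  define c where "c = circ_free (Suc N) occ p"
  have mono: "c \<in> circ_occ (Suc N) (insert c occ) ps" using circ_occ_mono by blast
  show ?case
  proof (cases "p = 0")
    case True
    have "0 \<notin> occ" using Cons.prems by auto
    then have "(LEAST d. (p + d) mod Suc N \<notin> occ) = 0"
      using True by (intro Least_eq_0) simp
    then have "c = 0" using True by (simp add: c_def circ_free_def)
    then show ?thesis using mono True by (simp add: c_def)
  next
    case False
    then have p: "1 \<le> p" "p \<le> N" using Cons.prems by auto
    have fin: "finite occ" using Cons.prems(1) finite_subset by blast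
    note f = circ_free_eq_first_free[OF Cons.prems(1) p]
    show ?thesis
    proof (cases "first_free occ p \<le> N")
      case True
      then have "c = first_free occ p" using f by (simp add: c_def)
      moreover from this have "insert c occ \<subseteq> {1..N}"
        using True first_free_notin[OF fin, of p] p Cons.prems by auto
      ultimately show ?thesis using Cons.IH[of "insert c occ"] Cons.prems p True
        by (simp add: c_def)
    next
      case False
      then have "c = 0" using f by (auto simp: c_def le_Suc_eq)
      then show ?thesis using mono False by (simp add: c_def)
    qed
  qed
qed

text \<open>
  Pollak's argument, as a double count of the pairs of a list in \<open>A\<close> and a spot that it leaves
  empty: each list leaves \<open>N + 1 - k\<close> spots empty, and by rotation each of the \<open>N + 1\<close> spots is left
  empty by as many lists as spot \<open>0\<close>.
\<close>

lemma card_rotation_invariant_PF: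
  assumes "k \<le> N"
    and A: "\<And>\<pi>. \<pi> \<in> A \<Longrightarrow> length \<pi> = k \<and> set \<pi> \<subseteq> {..N}"
    and closed: "\<And>\<pi> r. \<pi> \<in> A \<Longrightarrow> map (rot (Suc N) r) \<pi> \<in> A"
  shows "Suc N * card (A \<inter> PF k N) = (Suc N - k) * card A"
proof -
  define E where "E \<pi> = circ_occ (Suc N) {} \<pi>" for \<pi>
  have fin: "finite A"
    by (rule finite_subset[OF _ finite_lists_length_eq[of "{..N}" k]]) (use A in auto)
  have Esub: "E \<pi> \<subseteq> {..N}" for \<pi>
    using circ_occ_subset[of "Suc N" "{}" \<pi>] by (simp add: E_def lessThan_Suc_atMost)
  have cardE: "card {e \<in> {..N}. e \<notin> E \<pi>} = Suc N - k" if "\<pi> \<in> A" for \<pi>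
  proof -
    have "card (E \<pi>) = k" unfolding E_def
      using card_circ_occ[of "{}" "Suc N" \<pi>] A[OF that] assms(1)
      by (simp add: lessThan_Suc_atMost)
    moreover have "{e \<in> {..N}. e \<notin> E \<pi>} = {..N} - E \<pi>" by auto
    ultimately show ?thesis using Esub[of \<pi>] by (simp add: card_Diff_subset finite_subset)
  qed
  have zero: "{\<pi> \<in> A. 0 \<notin> E \<pi>} = A \<inter> PF k N"
  proof -
    have "\<pi> \<in> PF k N \<longleftrightarrow> 0 \<notin> E \<pi>" if "\<pi> \<in> A" for \<pi>
      using park_iff_zero_empty[of "{}" N \<pi>] A[OF that] by (simp add: PF_def E_def)
    then show ?thesis by blast
  qed
  have Erot: "E (map (rot (Suc N) r) \<pi>) = rot (Suc N) r ` E \<pi>" if "\<pi> \<in> A" for \<pi> r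
    using circ_occ_rot[of "{}" "Suc N" \<pi> r] A[OF that] by (simp add: E_def lessThan_Suc_atMost)
  have Emem: "rot (Suc N) r e \<in> E (map (rot (Suc N) r) \<pi>) \<longleftrightarrow> e \<in> E \<pi>"
    if "\<pi> \<in> A" "e \<le> N" for \<pi> r e
    unfolding Erot[OF that(1)] using Esub[of \<pi>] that(2)
    by (intro inj_on_image_mem_iff[OF inj_on_rot[of "Suc N" r]]) (auto simp: less_Suc_eq_le)
  have same: "card {\<pi> \<in> A. e \<notin> E \<pi>} = card (A \<inter> PF k N)" if "e \<le> N" for e
  proof -
    have r0: "rot (Suc N) (Suc N - e) e = 0" "rot (Suc N) e 0 = e"
      using that by (simp_all add: rot_def)
    have inv: "map (rot (Suc N) (Suc N - e)) (map (rot (Suc N) e) \<pi>) = \<pi>"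
      "map (rot (Suc N) e) (map (rot (Suc N) (Suc N - e)) \<pi>) = \<pi>" if "\<pi> \<in> A" for \<pi>
    proof -
      have lt: "x < Suc N" if "x \<in> set \<pi>" for x
        using A[OF \<open>\<pi> \<in> A\<close>] that by (auto simp: less_Suc_eq_le)
      show "map (rot (Suc N) (Suc N - e)) (map (rot (Suc N) e) \<pi>) = \<pi>"
        "map (rot (Suc N) e) (map (rot (Suc N) (Suc N - e)) \<pi>) = \<pi>"
        unfolding map_map comp_def
        by (rule map_idI, rule rot_inverse; use \<open>e \<le> N\<close> lt in simp)+
    qed
    have "bij_betw (map (rot (Suc N) (Suc N - e))) {\<pi> \<in> A. e \<notin> E \<pi>} {\<pi> \<in> A. 0 \<notin> E \<pi>}"
    proof (rule bij_betw_byWitness[where f' = "map (rot (Suc N) e)"])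
      show "map (rot (Suc N) (Suc N - e)) ` {\<pi> \<in> A. e \<notin> E \<pi>} \<subseteq> {\<pi> \<in> A. 0 \<notin> E \<pi>}"
        using Emem[OF _ that, of _ "Suc N - e"] closed by (auto simp: r0)
      show "map (rot (Suc N) e) ` {\<pi> \<in> A. 0 \<notin> E \<pi>} \<subseteq> {\<pi> \<in> A. e \<notin> E \<pi>}"
        using Emem[of _ 0 e] closed by (auto simp: r0)
    qed (use inv in auto)
    from bij_betw_same_card[OF this] show ?thesis unfolding zero .
  qed
  have "(Suc N - k) * card A = (\<Sum>\<pi>\<in>A. card {e \<in> {..N}. e \<notin> E \<pi>})"
  proof -
    have "(\<Sum>\<pi>\<in>A. card {e \<in> {..N}. e \<notin> E \<pi>}) = (\<Sum>\<pi>\<in>A. Suc N - k)"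
      by (rule sum.cong[OF refl]) (rule cardE)
    also have "\<dots> = (Suc N - k) * card A" by (simp only: sum_constant of_nat_id mult.commute)
    finally show ?thesis by (rule sym)
  qed
  also have "\<dots> = (\<Sum>e\<in>{..N}. card {\<pi> \<in> A. e \<notin> E \<pi>})"
    by (rule sum_multicount_gen) (use fin in auto)
  also have "\<dots> = Suc N * card (A \<inter> PF k N)" by (simp add: same)
  finally show ?thesis by (rule sym)
qed

section \<open>Leading elements and shuffles\<close>

lemma lel_eq_length_filter: "lel \<pi> = length (filter (\<lambda>x. x = hd \<pi>) \<pi>)"
  by (cases "\<pi> = []") (auto simp: lel_def length_filter_conv_card hd_conv_nth)

lemma lel_map_inj:
  assumes "inj_on f (set \<pi>)"
  shows "lel (map f \<pi>) = lel \<pi>"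
proof -
  have "map f \<pi> ! i = map f \<pi> ! 0 \<longleftrightarrow> \<pi> ! i = \<pi> ! 0" if "i < length \<pi>" for i
  proof -
    have "\<pi> ! 0 \<in> set \<pi>" "\<pi> ! i \<in> set \<pi>" using that by (auto intro!: nth_mem)
    moreover have "map f \<pi> ! i = f (\<pi> ! i)" "map f \<pi> ! 0 = f (\<pi> ! 0)"
      using that by (intro nth_map; linarith)+
    ultimately show ?thesis using inj_on_eq_iff[OF assms] by simp
  qed
  then show ?thesis unfolding lel_def by (metis length_map)
qed

lemma lel_filter:
  assumes "\<pi> \<noteq> []" "P (hd \<pi>)"
  shows "lel (filter P \<pi>) = lel \<pi>"
proof -
  have hd: "hd (filter P \<pi>) = hd \<pi>" using assms by (cases \<pi>) auto
  have "filter (\<lambda>x. x = hd \<pi>) (filter P \<pi>) = filter (\<lambda>x. x = hd \<pi>) \<pi>"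
    using assms(2) by (auto simp: filter_filter intro!: filter_cong)
  then show ?thesis unfolding lel_eq_length_filter hd by simp
qed

text \<open>
  A list with first entry in \<open>A\<close> is determined by its entries in \<open>A\<close>, its entries in \<open>B\<close>, and the
  way in which the tail of the former is shuffled with the latter. This one count serves three
  times: for high entries among low ones, for low entries among high ones, and for the leading
  elements among the others.
\<close>

lemma card_headed_shuffles:
  fixes A B :: "'a set"
  assumes AB: "A \<inter> B = {}" and "finite U" "finite V"
    and U: "\<And>u. u \<in> U \<Longrightarrow> set u \<subseteq> A \<and> length u = Suc a"
    and V: "\<And>v. v \<in> V \<Longrightarrow> set v \<subseteq> B \<and> length v = b"
  shows "card {\<pi>. \<pi> \<noteq> [] \<and> hd \<pi> \<in> A \<and> set \<pi> \<subseteq> A \<union> B \<and>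
      filter (\<lambda>x. x \<in> A) \<pi> \<in> U \<and> filter (\<lambda>x. x \<in> B) \<pi> \<in> V} = (a + b choose b) * card U * card V"
    (is "card ?S = _")
proof -
  \<comment> \<open>The fibre over a pair of sublists; its head is forced to be the head of the sublist in \<open>U\<close>.\<close>
  define W where "W = (\<lambda>(u :: 'a list, v). (#) (hd u) ` shuffles (tl u) v)"
  have dis: "set (tl u) \<inter> set v = {}" if "u \<in> U" "v \<in> V" for u v
    using U[OF that(1)] V[OF that(2)] AB by (cases u) auto
  have char: "x \<in> W (u, v) \<longleftrightarrow> x \<in> ?S \<and> filter (\<lambda>x. x \<in> A) x = u \<and> filter (\<lambda>x. x \<in> B) x = v"
    if uv: "u \<in> U" "v \<in> V" for u v x
  proof -
    obtain p u' where u: "u = p # u'" "p \<in> A" "set u' \<subseteq> A"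
      using U[OF uv(1)] by (cases u) auto
    have v: "set v \<subseteq> B" using V[OF uv(2)] by auto
    have pB: "p \<notin> B" using u AB by auto
    show ?thesis
    proof
      assume "x \<in> W (u, v)"
      then obtain y where y: "x = p # y" "y \<in> shuffles u' v" by (auto simp: W_def u)
      have "filter (\<lambda>x. x \<in> A) u' = u'" "filter (\<lambda>x. x \<in> A) v = []"
        "filter (\<lambda>x. x \<in> B) u' = []" "filter (\<lambda>x. x \<in> B) v = v"
        using u v AB by (auto simp: filter_id_conv filter_empty_conv)
      then have fl: "filter (\<lambda>x. x \<in> A) y = u'" "filter (\<lambda>x. x \<in> B) y = v"
        using filter_shuffles[of "\<lambda>x. x \<in> A" u' v] filter_shuffles[of "\<lambda>x. x \<in> B" u' v] y(2)
        by force+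
      moreover have "set y \<subseteq> A \<union> B" using set_shuffles[OF y(2)] u v by auto
      ultimately show "x \<in> ?S \<and> filter (\<lambda>x. x \<in> A) x = u \<and> filter (\<lambda>x. x \<in> B) x = v"
        using y(1) u pB uv by simp
    next
      assume x: "x \<in> ?S \<and> filter (\<lambda>x. x \<in> A) x = u \<and> filter (\<lambda>x. x \<in> B) x = v"
      then obtain q y where y: "x = q # y" by (cases x) auto
      with x u AB have q: "q = p" "filter (\<lambda>x. x \<in> A) y = u'" "filter (\<lambda>x. x \<in> B) y = v"
        "set y \<subseteq> A \<union> B" by (auto split: if_splits)
      have "filter (\<lambda>x. x \<notin> A) y = filter (\<lambda>x. x \<in> B) y"
        using q(4) AB by (intro filter_cong) auto
      then have "y \<in> shuffles u' v"
        using partition_in_shuffles[of y "\<lambda>x. x \<in> A"] q by simp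
      then show "x \<in> W (u, v)" using y q by (auto simp: W_def u)
    qed
  qed
  have cardW: "card (W (u, v)) = (a + b choose b)" if "u \<in> U" "v \<in> V" for u v
  proof -
    have "card (W (u, v)) = card (shuffles (tl u) v)"
      by (simp add: W_def card_image)
    also have "\<dots> = (length (tl u) + length v) choose length (tl u)"
      using dis[OF that] by (rule card_disjoint_shuffles)
    also have "\<dots> = (a + b choose b)"
      using U[OF that(1)] V[OF that(2)] binomial_symmetric[of a "a + b"] by simp
    finally show ?thesis .
  qed
  have "?S = (\<Union>w\<in>U \<times> V. W w)"
    using char by fastforce
  also have "card \<dots> = (\<Sum>w\<in>U \<times> V. card (W w))"
  proof (rule card_UN_disjoint)
    show "\<forall>w\<in>U \<times> V. finite (W w)" by (auto simp: W_def)
    show "\<forall>i\<in>U \<times> V. \<forall>j\<in>U \<times> V. i \<noteq> j \<longrightarrow> W i \<inter> W j = {}"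
    proof (intro ballI impI)
      fix i j assume ij: "i \<in> U \<times> V" "j \<in> U \<times> V" "i \<noteq> j"
      obtain u v u' v' where "i = (u, v)" "j = (u', v')" by (cases i, cases j) 
      then show "W i \<inter> W j = {}" using ij char[of u v] char[of u' v'] by auto
    qed
  qed (use assms in auto)
  also have "\<dots> = (\<Sum>w\<in>U \<times> V. (a + b choose b))"
    by (rule sum.cong) (auto simp: cardW)
  also have "\<dots> = (a + b choose b) * card U * card V"
    by (simp add: card_cartesian_product)
  finally show ?thesis .
qed

lemma card_lists_lel:
  assumes "finite A" "1 \<le> k" "1 \<le> t"
  shows "card {\<pi>. set \<pi> \<subseteq> A \<and> length \<pi> = k \<and> lel \<pi> = t} =
    card A * (k - 1 choose (t - 1)) * (card A - 1) ^ (k - t)"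
proof (cases "t \<le> k")
  case False
  have "lel \<pi> \<le> length \<pi>" for \<pi> :: "nat list" by (simp add: lel_eq_length_filter)
  then have "{\<pi>. set \<pi> \<subseteq> A \<and> length \<pi> = k \<and> lel \<pi> = t} = {}" using False by force
  then have "card {\<pi>. set \<pi> \<subseteq> A \<and> length \<pi> = k \<and> lel \<pi> = t} = 0" by (simp only: card.empty)
  then show ?thesis using False assms by (simp add: binomial_eq_0)
next
  case True
  \<comment> \<open>Fix the leading value \<open>p\<close> and shuffle \<open>t\<close> copies of it with a list that avoids \<open>p\<close>.\<close>
  define V where "V p = {v. set v \<subseteq> A - {p} \<and> length v = k - t}" for p
  define S where "S p = {\<pi>. \<pi> \<noteq> [] \<and> hd \<pi> \<in> {p} \<and> set \<pi> \<subseteq> {p} \<union> (A - {p}) \<and>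
      filter (\<lambda>x. x \<in> {p}) \<pi> \<in> {replicate t p} \<and> filter (\<lambda>x. x \<in> A - {p}) \<pi> \<in> V p}" for p
  have cardS: "card (S p) = (k - 1 choose (t - 1)) * (card A - 1) ^ (k - t)" if "p \<in> A" for p
  proof -
    have "card (S p) = (t - 1 + (k - t) choose (k - t)) * card {replicate t p} * card (V p)"
      unfolding S_def
      by (rule card_headed_shuffles) (use assms in \<open>auto simp: V_def finite_lists_length_eq\<close>)
    moreover have "card (V p) = (card A - 1) ^ (k - t)"
      unfolding V_def using assms that by (subst card_lists_length_eq) auto
    moreover have "(k - 1 choose (k - t)) = (k - 1 choose (t - 1))"
      using binomial_symmetric[of "t - 1" "k - 1"] True assms by simp
    ultimately show ?thesis using True assms by simp
  qed
  have eq: "{\<pi>. set \<pi> \<subseteq> A \<and> length \<pi> = k \<and> lel \<pi> = t} = (\<Union>p\<in>A. S p)"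
  proof (intro equalityI subsetI)
    fix \<pi> assume "\<pi> \<in> {\<pi>. set \<pi> \<subseteq> A \<and> length \<pi> = k \<and> lel \<pi> = t}"
    then have pi: "set \<pi> \<subseteq> A" "length \<pi> = k" "lel \<pi> = t" by auto
    define p where "p = hd \<pi>"
    have ne: "\<pi> \<noteq> []" using pi assms by auto
    then have "p \<in> A" using pi by (auto simp: p_def)
    have len: "length (filter (\<lambda>x. x = p) \<pi>) = t" using pi by (simp add: lel_eq_length_filter p_def)
    have rep: "filter (\<lambda>x. x = p) \<pi> = replicate t p"
      using len by (rule replicate_eqI) auto
    have "filter (\<lambda>x. x \<in> A \<and> x \<noteq> p) \<pi> = filter (\<lambda>x. x \<noteq> p) \<pi>"
      using pi by (intro filter_cong) auto
    then have "length (filter (\<lambda>x. x \<in> A \<and> x \<noteq> p) \<pi>) = k - t"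
      using sum_length_filter_compl[of "\<lambda>x. x = p" \<pi>] len pi by simp
    then have "\<pi> \<in> S p" using pi ne rep \<open>p \<in> A\<close> unfolding S_def V_def
      by (auto simp: p_def[symmetric])
    then show "\<pi> \<in> (\<Union>p\<in>A. S p)" using \<open>p \<in> A\<close> by blast
  next
    fix \<pi> assume "\<pi> \<in> (\<Union>p\<in>A. S p)"
    then obtain p where p: "p \<in> A" "\<pi> \<in> S p" by blast
    then have pi: "hd \<pi> = p" "set \<pi> \<subseteq> A" "filter (\<lambda>x. x = p) \<pi> = replicate t p"
      "length (filter (\<lambda>x. x \<in> A \<and> x \<noteq> p) \<pi>) = k - t" by (auto simp: S_def V_def)
    have "filter (\<lambda>x. x \<in> A \<and> x \<noteq> p) \<pi> = filter (\<lambda>x. x \<noteq> p) \<pi>"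
      using pi by (intro filter_cong) auto
    then have "length \<pi> = k"
      using sum_length_filter_compl[of "\<lambda>x. x = p" \<pi>] pi True by simp
    then show "\<pi> \<in> {\<pi>. set \<pi> \<subseteq> A \<and> length \<pi> = k \<and> lel \<pi> = t}"
      using pi by (simp add: lel_eq_length_filter)
  qed
  have finS: "finite (S p)" if "p \<in> A" for p
  proof (rule finite_subset)
    show "S p \<subseteq> {\<pi>. set \<pi> \<subseteq> A \<and> length \<pi> = k}" using eq that by blast
  qed (use assms in \<open>simp add: finite_lists_length_eq\<close>)
  have "card (\<Union>p\<in>A. S p) = (\<Sum>p\<in>A. card (S p))"
    by (rule card_UN_disjoint) (use assms finS in \<open>auto simp: S_def\<close>)
  then show ?thesis by (simp add: eq cardS)
qed

section \<open>Counting parking functions\<close>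

lemma finite_PF: "finite (PF m n)"
  by (rule finite_subset[OF _ finite_lists_length_eq[of "{1..n}" m]]) (auto simp: PF_def)

lemma card_PF:
  assumes "k \<le> N"
  shows "Suc N * card (PF k N) = (Suc N - k) * Suc N ^ k"
proof -
  define A where "A = {\<pi>. set \<pi> \<subseteq> {..N} \<and> length \<pi> = k}"
  have "Suc N * card (A \<inter> PF k N) = (Suc N - k) * card A"
    by (rule card_rotation_invariant_PF) (use assms in \<open>auto simp: A_def rot_less simp flip: less_Suc_eq_le\<close>)
  moreover have "A \<inter> PF k N = PF k N" by (auto simp: A_def PF_def)
  moreover have "card A = Suc N ^ k" by (simp add: A_def card_lists_length_eq)
  ultimately show ?thesis by simp
qed

text \<open>
  Dividing \<open>card_lists_lel\<close> for the \<open>N + 1\<close> spots of the circle by \<open>N + 1\<close> leaves no denominator,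
  because the leading value is free to take any of these spots.
\<close>

lemma card_PF_lel:
  assumes "1 \<le> k" "k \<le> N" "1 \<le> t"
  shows "card {\<pi> \<in> PF k N. lel \<pi> = t} = (Suc N - k) * (k - 1 choose (t - 1)) * N ^ (k - t)"
proof -
  define A where "A = {\<pi>. set \<pi> \<subseteq> {..N} \<and> length \<pi> = k \<and> lel \<pi> = t}"
  have "Suc N * card (A \<inter> PF k N) = (Suc N - k) * card A"
  proof (rule card_rotation_invariant_PF)
    fix \<pi> r assume pi: "\<pi> \<in> A"
    have "inj_on (rot (Suc N) r) (set \<pi>)"
      by (rule inj_on_subset[OF inj_on_rot]) (use pi in \<open>auto simp: A_def less_Suc_eq_le\<close>)
    from lel_map_inj[OF this] show "map (rot (Suc N) r) \<pi> \<in> A"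
      using pi rot_less[of "Suc N" r] by (auto simp: A_def less_Suc_eq_le)
  qed (use assms in \<open>auto simp: A_def\<close>)
  moreover have "A \<inter> PF k N = {\<pi> \<in> PF k N. lel \<pi> = t}" by (auto simp: A_def PF_def)
  moreover have "card A = Suc N * (k - 1 choose (t - 1)) * N ^ (k - t)"
    using card_lists_lel[of "{..N}" k t] assms by (simp add: A_def)
  ultimately have "Suc N * card {\<pi> \<in> PF k N. lel \<pi> = t} =
      Suc N * ((Suc N - k) * (k - 1 choose (t - 1)) * N ^ (k - t))"
    by (simp only: ac_simps)
  then show ?thesis by (simp only: nat_mult_eq_cancel1[OF zero_less_Suc])
qed

text \<open>
  With \<open>L = n - m + 1\<close>, the bound on the tail count at \<open>j + L\<close> is \<open>n - (j + L) + 1 = (m - 1) - j + 1\<close>,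
  which is the bound at \<open>j\<close> for a street with \<open>m - 1\<close> spots.
\<close>

lemma PF_iff_high_part:
  assumes "m \<le> n" "length \<pi> = m" "set \<pi> \<subseteq> {1..n}" "1 \<le> m"
    and "filter (\<lambda>x. n - m + 1 < x) \<pi> = map (\<lambda>x. x + (n - m + 1)) v"
  shows "\<pi> \<in> PF m n \<longleftrightarrow> v \<in> PF (length v) (m - 1)"
proof -
  define L where "L = n - m + 1"
  have nL: "n + 1 = m + L" using assms(1) by (simp add: L_def)
  have count: "length (filter (\<lambda>x. j + L \<le> x) \<pi>) = length (filter (\<lambda>x. j \<le> x) v)" if "1 \<le> j" for j
  proof -
    have "filter (\<lambda>x. j + L \<le> x) \<pi> = filter (\<lambda>x. j + L \<le> x) (filter (\<lambda>x. L < x) \<pi>)"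
      unfolding filter_filter by (rule filter_cong) (use that in auto)
    also have "\<dots> = filter (\<lambda>x. j + L \<le> x) (map (\<lambda>x. x + L) v)"
      using assms(5) by (simp add: L_def)
    finally show ?thesis by (simp add: filter_map comp_def)
  qed
  have v: "set v \<subseteq> {1..m - 1}"
  proof
    fix x assume "x \<in> set v"
    then have "x + L \<in> set (filter (\<lambda>x. L < x) \<pi>)"
      unfolding assms(5)[folded L_def] by simp
    then have "L < x + L" "x + L \<le> n" using assms(3) by auto
    then show "x \<in> {1..m - 1}" using nL by auto
  qed
  have "(\<forall>j\<in>{1..n}. length (filter (\<lambda>x. j \<le> x) \<pi>) + j \<le> n + 1) \<longleftrightarrow>
        (\<forall>j\<in>{1..m - 1}. length (filter (\<lambda>x. j \<le> x) v) + j \<le> (m - 1) + 1)" (is "?l \<longleftrightarrow> ?r")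
  proof
    assume l: ?l
    show ?r
    proof
      fix j assume j: "j \<in> {1..m - 1}"
      then have "j + L \<in> {1..n}" using assms by (auto simp: L_def)
      then show "length (filter (\<lambda>x. j \<le> x) v) + j \<le> (m - 1) + 1"
        using l[rule_format, of "j + L"] count[of j] j assms by (auto simp: L_def)
    qed
  next
    assume r: ?r
    show ?l
    proof
      fix j assume j: "j \<in> {1..n}"
      show "length (filter (\<lambda>x. j \<le> x) \<pi>) + j \<le> n + 1"
      proof (cases "j \<le> L")
        case True
        \<comment> \<open>In the level set the bound is at least \<open>n - L + 1 = m\<close>, the number of all cars.\<close>
        have "length (filter (\<lambda>x. j \<le> x) \<pi>) \<le> m" using assms by auto
        then show ?thesis using True assms by (simp add: L_def)
      next
        case False
        define i where "i = j - L"
        have i: "j = i + L" "1 \<le> i" using False by (auto simp: i_def)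
        have "i \<in> {1..m - 1}" using i j nL by auto
        then have "length (filter (\<lambda>x. i \<le> x) v) + i \<le> (m - 1) + 1" by (rule bspec[OF r])
        then show ?thesis unfolding i(1) count[OF i(2)] using nL assms(4) by linarith
      qed
    qed
  qed
  then show ?thesis using assms v by (simp add: PF_iff_tail_counts)
qed


lemma PF_slev_iff:
  assumes "1 \<le> m" "m \<le> n" "1 \<le> s" "s \<le> m"
  defines "L \<equiv> n - m + 1"
  shows "\<pi> \<in> PF m n \<and> slev n \<pi> = s \<longleftrightarrow> set \<pi> \<subseteq> {1..L} \<union> {L + 1..n} \<and>
    length (filter (\<lambda>x. x \<in> {1..L}) \<pi>) = s \<and>
    filter (\<lambda>x. x \<in> {L + 1..n}) \<pi> \<in> map (\<lambda>x. x + L) ` PF (m - s) (m - 1)" (is "?l \<longleftrightarrow> ?r")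
proof -
  have un: "{1..L} \<union> {L + 1..n} = {1..n}" using assms by (auto simp: L_def)
  have slev: "slev n \<pi> = length (filter (\<lambda>x. x \<in> {1..L}) \<pi>)" if "length \<pi> = m"
    using that by (simp add: slev_def length_filter_conv_card L_def)
  have high: "filter (\<lambda>x. L < x) \<pi> = filter (\<lambda>x. x \<in> {L + 1..n}) \<pi>"
    and low: "filter (\<lambda>x. \<not> x \<in> {1..L}) \<pi> = filter (\<lambda>x. x \<in> {L + 1..n}) \<pi>"
    if "set \<pi> \<subseteq> {1..n}"
    using that by (auto intro!: filter_cong)
  have len: "length \<pi> = length (filter (\<lambda>x. x \<in> {1..L}) \<pi>) + length (filter (\<lambda>x. x \<in> {L + 1..n}) \<pi>)"
    if "set \<pi> \<subseteq> {1..n}"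
    using sum_length_filter_compl[of "\<lambda>x. x \<in> {1..L}" \<pi>] low[OF that] by simp
  show ?thesis
  proof
    assume l: ?l
    then have pi: "length \<pi> = m" "set \<pi> \<subseteq> {1..n}" by (auto simp: PF_def)
    define v where "v = map (\<lambda>x. x - L) (filter (\<lambda>x. x \<in> {L + 1..n}) \<pi>)"
    have v: "filter (\<lambda>x. x \<in> {L + 1..n}) \<pi> = map (\<lambda>x. x + L) v"
      unfolding v_def map_map by (rule map_idI[symmetric]) auto
    have lenv: "length v = m - s" using len pi l slev by (simp add: v_def)
    have "v \<in> PF (m - s) (m - 1)"
      using PF_iff_high_part[of m n \<pi> v] pi assms l v high lenv by (simp add: L_def)
    then show ?r using pi un v l slev by auto
  next
    assume r: ?r
    then obtain v where v: "filter (\<lambda>x. x \<in> {L + 1..n}) \<pi> = map (\<lambda>x. x + L) v"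
      "v \<in> PF (m - s) (m - 1)" by blast
    have pi: "set \<pi> \<subseteq> {1..n}" using r un by simp
    have lenv: "length v = m - s" using v by (simp add: PF_def)
    have "length \<pi> = m" using len[OF pi] r v lenv assms by simp
    then show ?l
      using PF_iff_high_part[of m n \<pi> v] pi assms r v high lenv slev by (simp add: L_def)
  qed
qed

text \<open>
  The two summands are the cases of a high and of a low first entry. For \<open>s = m\<close> there is no high
  entry, in agreement with \<open>m - 1 choose s = 0\<close>.
\<close>

lemma card_PF_slev_lel:
  assumes "1 \<le> m" "m \<le> n" "1 \<le> s" "s \<le> m" "1 \<le> t"
  defines "L \<equiv> n - m + 1"
  shows "card {\<pi> \<in> PF m n. slev n \<pi> = s \<and> lel \<pi> = t} =
      (m - 1 choose s) * (s * (m - s - 1 choose (t - 1)) * (m - 1) ^ (m - s - t)) * L ^ s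
    + (m - 1 choose (m - s)) * (L * (s - 1 choose (t - 1)) * (L - 1) ^ (s - t)) * card (PF (m - s) (m - 1))"
proof -
  define A where "A = {1..L}"
  define B where "B = {L + 1..n}"
  define sh where "sh = map (\<lambda>x::nat. x + L)"
  have AB: "A \<inter> B = {}" by (auto simp: A_def B_def)
  have sh_inj: "inj sh" unfolding sh_def by (simp add: inj_on_def)
  have sh_lel: "lel (sh v) = lel v" for v
    unfolding sh_def by (rule lel_map_inj) (simp add: inj_on_def)
  have nL: "n + 1 = m + L" using assms by (simp add: L_def)
  have sh_PF: "set (sh v) \<subseteq> B \<and> length (sh v) = m - s" if "v \<in> PF (m - s) (m - 1)" for v
    using that nL by (fastforce simp: PF_def sh_def B_def)
  note iff = PF_slev_iff[OF assms(1-4), folded L_def, folded A_def B_def sh_def]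
  define Low where "Low = {\<pi>. \<pi> \<noteq> [] \<and> hd \<pi> \<in> A \<and> set \<pi> \<subseteq> A \<union> B \<and>
    filter (\<lambda>x. x \<in> A) \<pi> \<in> {u. set u \<subseteq> A \<and> length u = s \<and> lel u = t} \<and>
    filter (\<lambda>x. x \<in> B) \<pi> \<in> sh ` PF (m - s) (m - 1)}"
  define High where "High = {\<pi>. \<pi> \<noteq> [] \<and> hd \<pi> \<in> B \<and> set \<pi> \<subseteq> B \<union> A \<and>
    filter (\<lambda>x. x \<in> B) \<pi> \<in> sh ` {v \<in> PF (m - s) (m - 1). lel v = t} \<and>
    filter (\<lambda>x. x \<in> A) \<pi> \<in> {u. set u \<subseteq> A \<and> length u = s}}"
  have ne: "\<pi> \<noteq> []" if "\<pi> \<in> PF m n" for \<pi> using that assms by (auto simp: PF_def)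
  have lowS: "Low = {\<pi> \<in> PF m n. slev n \<pi> = s \<and> lel \<pi> = t \<and> hd \<pi> \<in> A}"
    using iff ne lel_filter[of _ "\<lambda>x. x \<in> A"] unfolding Low_def by auto
  have highS: "High = {\<pi> \<in> PF m n. slev n \<pi> = s \<and> lel \<pi> = t \<and> hd \<pi> \<in> B}"
  proof (intro equalityI subsetI)
    fix \<pi> assume h: "\<pi> \<in> High"
    then have "lel \<pi> = t" using lel_filter[of \<pi> "\<lambda>x. x \<in> B"] sh_lel by (auto simp: High_def)
    then show "\<pi> \<in> {\<pi> \<in> PF m n. slev n \<pi> = s \<and> lel \<pi> = t \<and> hd \<pi> \<in> B}"
      using h iff[of \<pi>] by (auto simp: High_def)
  next
    fix \<pi> assume h: "\<pi> \<in> {\<pi> \<in> PF m n. slev n \<pi> = s \<and> lel \<pi> = t \<and> hd \<pi> \<in> B}"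
    then obtain v where v: "filter (\<lambda>x. x \<in> B) \<pi> = sh v" "v \<in> PF (m - s) (m - 1)"
      using iff[of \<pi>] by auto
    moreover from this have "lel v = t"
      using h lel_filter[of \<pi> "\<lambda>x. x \<in> B"] sh_lel[of v] ne by auto
    ultimately show "\<pi> \<in> High" using h iff[of \<pi>] ne unfolding High_def by auto
  qed
  have "hd \<pi> \<in> A \<union> B" if "\<pi> \<in> PF m n" "slev n \<pi> = s" for \<pi>
    using that iff[of \<pi>] ne[of \<pi>] by (meson hd_in_set subsetD)
  then have S: "{\<pi> \<in> PF m n. slev n \<pi> = s \<and> lel \<pi> = t} = High \<union> Low" and dis: "High \<inter> Low = {}"
    unfolding lowS highS using AB by blast+
  have fin: "finite High" "finite Low"
    unfolding lowS highS using finite_PF[of m n] by simp_all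
  have "card Low = (s - 1 + (m - s) choose (m - s)) * card {u. set u \<subseteq> A \<and> length u = s \<and> lel u = t}
      * card (sh ` PF (m - s) (m - 1))"
    unfolding Low_def
  proof (rule card_headed_shuffles[OF AB])
    show "finite {u. set u \<subseteq> A \<and> length u = s \<and> lel u = t}"
      by (rule finite_subset[OF _ finite_lists_length_eq[of A s]]) (auto simp: A_def)
  qed (use sh_PF finite_PF assms in auto)
  also have "card {u. set u \<subseteq> A \<and> length u = s \<and> lel u = t} =
      L * (s - 1 choose (t - 1)) * (L - 1) ^ (s - t)"
    using card_lists_lel[of A s t] assms by (simp add: A_def)
  also have "card (sh ` PF (m - s) (m - 1)) = card (PF (m - s) (m - 1))"
    by (rule card_image) (use sh_inj in \<open>auto intro: inj_on_subset\<close>)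
  also have "s - 1 + (m - s) = m - 1" using assms by simp
  finally have cardLow: "card Low = (m - 1 choose (m - s)) *
      (L * (s - 1 choose (t - 1)) * (L - 1) ^ (s - t)) * card (PF (m - s) (m - 1))" .
  have cardHigh: "card High =
      (m - 1 choose s) * (s * (m - s - 1 choose (t - 1)) * (m - 1) ^ (m - s - t)) * L ^ s"
  proof (cases "s = m")
    case True
    have "High = {}"
    proof (rule ccontr)
      assume "High \<noteq> {}"
      then obtain \<pi> where "\<pi> \<noteq> []" "hd \<pi> \<in> B" "filter (\<lambda>x. x \<in> B) \<pi> = []"
        using sh_PF True unfolding High_def by fastforce
      then show False by (cases \<pi>) auto
    qed
    then show ?thesis using True assms by (simp add: binomial_eq_0)
  next
    case False
    have "card High = (m - s - 1 + s choose s) * card (sh ` {v \<in> PF (m - s) (m - 1). lel v = t})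
        * card {u. set u \<subseteq> A \<and> length u = s}"
      unfolding High_def
    proof (rule card_headed_shuffles)
      show "finite (sh ` {v \<in> PF (m - s) (m - 1). lel v = t})"
        using finite_PF[of "m - s" "m - 1"] by simp
      fix u assume "u \<in> sh ` {v \<in> PF (m - s) (m - 1). lel v = t}"
      then show "set u \<subseteq> B \<and> length u = Suc (m - s - 1)" using sh_PF False assms by auto
    qed (use AB in \<open>auto simp: A_def finite_lists_length_eq\<close>)
    also have "card {u. set u \<subseteq> A \<and> length u = s} = L ^ s"
      by (simp add: card_lists_length_eq A_def)
    also have "card (sh ` {v \<in> PF (m - s) (m - 1). lel v = t}) = card {v \<in> PF (m - s) (m - 1). lel v = t}"
      by (rule card_image) (use sh_inj in \<open>auto intro: inj_on_subset\<close>)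
    also have "\<dots> = s * (m - s - 1 choose (t - 1)) * (m - 1) ^ (m - s - t)"
      using card_PF_lel[of "m - s" "m - 1" t] False assms by simp
    also have "m - s - 1 + s = m - 1" using False assms by simp
    finally show ?thesis .
  qed
  show ?thesis unfolding S card_Un_disjoint[OF fin dis] cardLow cardHigh ..
qed

section \<open>The closed formula\<close>

text \<open>
  Absorbing the factor \<open>s\<close> into the binomial coefficient \<open>m - 1 choose s\<close> turns it into
  \<open>m - 1\<close> times \<open>m - 2 choose (s - 1)\<close>; this is where the exponent \<open>m - s - t + 1\<close>
  and the upper entry \<open>m - 2\<close> of the trinomial come from.
\<close>

lemma trinomial_high:
  assumes "1 \<le> s" "s \<le> m" "1 \<le> t"
  shows "trinomial (int m - 2) (int s - 1) (int t - 1) (int m - int s - int t)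
      * (real m - 1) powi (int m - int s - int t + 1)
    = real ((m - 1 choose s) * (s * (m - s - 1 choose (t - 1)) * (m - 1) ^ (m - s - t)))"
proof (cases "s + t \<le> m")
  case False
  then have "(m - 1 choose s) * (m - s - 1 choose (t - 1)) = 0"
    using assms by (cases "s = m") (auto simp: binomial_eq_0)
  moreover have "trinomial (int m - 2) (int s - 1) (int t - 1) (int m - int s - int t) = 0"
    using False by (simp add: trinomial_def)
  ultimately show ?thesis by auto
next
  case True
  define a where "a = s - 1"
  define b where "b = t - 1"
  define j where "j = m - s - t"
  have subst: "s = Suc a" "t = Suc b" "m = Suc (Suc (a + b + j))"
    using assms True by (auto simp: a_def b_def j_def)
  have tri: "trinomial (int m - 2) (int s - 1) (int t - 1) (int m - int s - int t) =
      fact (a + b + j) / (fact a * fact b * fact j)"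
    by (simp add: subst trinomial_def nat_add_distrib add.assoc)
  have e: "int m - int s - int t + 1 = int (Suc j)" by (simp add: subst)
  have pw: "(real m - 1) powi (int m - int s - int t + 1) = real (Suc (a + b + j)) * real (m - 1) ^ j"
    unfolding e power_int_of_nat by (simp add: subst add.assoc)
  have b1: "real (m - 1 choose s) = fact (Suc (a + b + j)) / (fact (Suc a) * fact (b + j))"
    using binomial_fact[of "Suc a" "Suc (a + b + j)", where 'a = real] by (simp add: subst)
  have b2: "real (m - s - 1 choose (t - 1)) = fact (b + j) / (fact b * fact j)"
    using binomial_fact[of b "b + j", where 'a = real] by (simp add: subst)
  have "fact (a + b + j) / (fact a * fact b * fact j) * real (Suc (a + b + j)) =
    fact (Suc (a + b + j)) / (fact (Suc a) * fact (b + j)) * (real s * (fact (b + j) / (fact b * fact j)))"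
    by (simp add: subst field_simps del: of_nat_Suc)
  moreover have "m - s - t = j" by (simp add: j_def)
  ultimately show ?thesis
    unfolding tri pw of_nat_mult of_nat_power b1 b2 by (simp only: mult.assoc[symmetric])
qed

lemma trinomial_low:
  assumes "1 \<le> s" "s \<le> m" "1 \<le> t"
  shows "trinomial (int m - 1) (int t - 1) (int s - int t) (int m - int s) * x powi (int s - int t)
    = real ((m - 1 choose (m - s)) * (s - 1 choose (t - 1))) * x ^ (s - t)"
proof (cases "t \<le> s")
  case False
  then show ?thesis using assms by (simp add: trinomial_def binomial_eq_0)
next
  case True
  define b where "b = t - 1"
  define i where "i = s - t"
  define k where "k = m - s"
  have subst: "t = Suc b" "s = Suc (b + i)" "m = Suc (b + i + k)"
    using assms True by (auto simp: b_def i_def k_def)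
  have "real (m - 1 choose (m - s)) = fact (b + i + k) / (fact k * fact (b + i))"
    using binomial_fact[of k "b + i + k", where 'a = real] by (simp add: subst)
  moreover have "real (s - 1 choose (t - 1)) = fact (b + i) / (fact b * fact i)"
    using binomial_fact[of b "b + i", where 'a = real] by (simp add: subst)
  moreover have "trinomial (int m - 1) (int t - 1) (int s - int t) (int m - int s) =
      fact (b + i + k) / (fact b * fact i * fact k)"
    by (simp add: subst trinomial_def nat_add_distrib)
  moreover have "x powi (int s - int t) = x ^ (s - t)"
    using True power_int_of_nat[of x "s - t"] by (simp add: of_nat_diff)
  ultimately show ?thesis by simp
qed

text \<open>
  For \<open>s = m\<close> the exponent is \<open>- 1\<close>, and the value is \<open>m * m\<^sup>-\<^sup>1 = 1\<close>, the empty parking function.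
\<close>

lemma real_card_PF:
  assumes "1 \<le> s" "s \<le> m"
  shows "real (card (PF (m - s) (m - 1))) = real s * real m powi (int m - int s - 1)"
proof -
  have "m * card (PF (m - s) (m - 1)) = s * m ^ (m - s)"
    using card_PF[of "m - s" "m - 1"] assms by simp
  then have "real m * real (card (PF (m - s) (m - 1))) = real s * real m ^ (m - s)"
    by (metis of_nat_mult of_nat_power)
  then have "real (card (PF (m - s) (m - 1))) = real s * (real m ^ (m - s) / real m)"
    using assms by (simp add: nonzero_eq_divide_eq mult.commute)
  moreover have "real m powi (int (m - s) - 1) = real m ^ (m - s) / real m"
    using assms by (subst power_int_diff) (auto simp: power_int_of_nat simp del: of_nat_diff)
  moreover have "int m - int s - 1 = int (m - s) - 1" using assms by simp
  ultimately show ?thesis by (simp only:)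
qed

theorem theorem2p4:
  fixes m n s t :: nat
  assumes "1 \<le> m" and "m \<le> n" and "1 \<le> s" and "1 \<le> t"
  shows "real (card {\<pi> \<in> PF m n. slev n \<pi> = s \<and> lel \<pi> = t}) =
      trinomial (int m - 2) (int s - 1) (int t - 1) (int m - int s - int t)
        * (real n - real m + 1) ^ s
        * (real m - 1) powi (int m - int s - int t + 1)
    + trinomial (int m - 1) (int t - 1) (int s - int t) (int m - int s)
        * real s * (real n - real m + 1)
        * (real n - real m) powi (int s - int t)
        * real m powi (int m - int s - 1)"
proof (cases "s \<le> m")
  case False
  \<comment> \<open>More level elements than cars: both trinomials have a negative lower entry.\<close>
  have "slev n \<pi> \<le> m" if "\<pi> \<in> PF m n" for \<pi>
    using that card_mono[of "{..<m}" "{i. i < m \<and> \<pi> ! i \<in> {1..n - m + 1}}"]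
    by (auto simp: PF_def slev_def)
  then have "{\<pi> \<in> PF m n. slev n \<pi> = s \<and> lel \<pi> = t} = {}" using False by force
  then have "card {\<pi> \<in> PF m n. slev n \<pi> = s \<and> lel \<pi> = t} = 0"
    by (simp only: card.empty)
  then show ?thesis using False assms by (simp add: trinomial_def)
next
  case True
  have L: "real (n - m) = real n - real m"
    using assms by (simp add: of_nat_diff)
  have "real (card {\<pi> \<in> PF m n. slev n \<pi> = s \<and> lel \<pi> = t}) =
      real ((m - 1 choose s) * (s * (m - s - 1 choose (t - 1)) * (m - 1) ^ (m - s - t)))
        * (real n - real m + 1) ^ s
    + real ((m - 1 choose (m - s)) * (s - 1 choose (t - 1))) * (real n - real m) ^ (s - t)
        * (real n - real m + 1) * real (card (PF (m - s) (m - 1)))"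
    unfolding card_PF_slev_lel[OF assms(1-3) True assms(4)]
    by (simp only: of_nat_add of_nat_mult of_nat_power of_nat_1 L add_diff_cancel_right')
      (simp only: ac_simps)
  then show ?thesis
    unfolding trinomial_high[OF assms(3) True assms(4), symmetric]
      trinomial_low[OF assms(3) True assms(4), symmetric] real_card_PF[OF assms(3) True]
    by (simp only: ac_simps)
qed

end
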